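(* Let $\sigma$ be a special $P$-morphism on $\mathcal A$, let $\mathbf t$ be an infinite word over $\mathcal A$ and $\mathbf s=\sigma(\mathbf t)$. Then $\mathbf s$ is almost rich if and only if $\mathbf t$ is almost rich.
   Context: For a finite word $w$, $D(w)=|w|+1-|\mathrm{PAL}(w)|$ with $\mathrm{PAL}(w)$ its set of distinct palindromic factors (including the empty word); an infinite word is almost rich if the defects of its factors are bounded. A standard $P$-morphism is a morphism $\varphi$ on $\mathcal A$ for which there is a palindrome $p$ (possibly empty) with $\varphi(x)=pq_x$ for all $x$, where each $q_x$ is a palindrome (possibly empty), or, when $p$ is non-empty, $q_x=\pi_x^{-1}$ with $\pi_x$ a proper palindromic suffix of $p$. It is special if (1) the words $\varphi(x)$ end with pairwise different letters, and (2) whenever $pq_xp$ occurs as a factor of some $\varphi(y_1\cdots y_n)p$, this occurrence is the occurrence of $\varphi(y_m)p$ starting right after $\varphi(y_1\cdots y_{m-1})$ for some $1\le m\le n$. A $P$-morphism is a morphism $\psi(x)=p''q_xp'$ ($x\in\mathcal A$) obtained from a standard $P$-morphism $\varphi(x)=pq_x$ and a factorization $p=p'p''$; it is special if the corresponding standard $P$-morphism $\varphi$ is special. *)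

theory Defs
  imports "HOL-Library.Sublist" "HOL-Library.Stream"
begin

definition palindrome :: "'a list \<Rightarrow> bool" where
  "palindrome w \<longleftrightarrow> rev w = w"

definition PAL :: "'a list \<Rightarrow> 'a list set" where
  "PAL w = {v. sublist v w \<and> palindrome v}"

definition defect :: "'a list \<Rightarrow> int" where
  "defect w = int (length w) + 1 - int (card (PAL w))"

definition factors :: "'a stream \<Rightarrow> 'a list set" where
  "factors s = {stake n (sdrop i s) | i n. True}"

definition almost_rich :: "'a stream \<Rightarrow> bool" where
  "almost_rich s \<longleftrightarrow> (\<exists>B. \<forall>w \<in> factors s. defect w \<le> B)"

text \<open>A morphism is given by its values on letters.\<close>

definition ext :: "('a \<Rightarrow> 'b list) \<Rightarrow> 'a list \<Rightarrow> 'b list" where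
  "ext f w = concat (map f w)"

text \<open>The library's \<^const>\<open>flat\<close> is infinite concatenation only for nonempty blocks; all letter
  images under a special P-morphism are nonempty.\<close>

definition ext_inf :: "('a \<Rightarrow> 'b list) \<Rightarrow> 'a stream \<Rightarrow> 'b stream" where
  "ext_inf f t = flat (smap f t)"

text \<open>The words \<open>q\<^sub>x\<close> are either ordinary words (\<open>Pos q\<close>) or formal inverses \<open>\<pi>\<^sup>-\<^sup>1\<close> (\<open>Neg \<pi>\<close>).
  \<open>sandwich u q v w\<close> says that \<open>u q v = w\<close> holds in the free group: a product
  \<open>u \<pi>\<^sup>-\<^sup>1 v\<close> is a word iff \<open>\<pi> = \<pi>\<^sub>1 \<pi>\<^sub>2\<close> where \<open>\<pi>\<^sub>2\<close> cancels a suffix of \<open>u\<close> and \<open>\<pi>\<^sub>1\<close> cancels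
  a prefix of \<open>v\<close>, and the word obtained is the same for every such factorization.\<close>

datatype 'a tail = Pos "'a list" | Neg "'a list"

fun sandwich :: "'a list \<Rightarrow> 'a tail \<Rightarrow> 'a list \<Rightarrow> 'a list \<Rightarrow> bool" where
  "sandwich u (Pos q) v w \<longleftrightarrow> w = u @ q @ v"
| "sandwich u (Neg \<pi>) v w \<longleftrightarrow>
     (\<exists>\<pi>1 \<pi>2 u' v'. \<pi> = \<pi>1 @ \<pi>2 \<and> u = u' @ \<pi>2 \<and> v = \<pi>1 @ v' \<and> w = u' @ v')"

text \<open>\<open>Neg\<close> is possible only for nonempty \<open>p\<close>, since \<open>[]\<close> has no strict suffix.\<close>

fun admissible_tail :: "'a list \<Rightarrow> 'a tail \<Rightarrow> bool" where
  "admissible_tail p (Pos q) \<longleftrightarrow> palindrome q"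
| "admissible_tail p (Neg \<pi>) \<longleftrightarrow> palindrome \<pi> \<and> strict_suffix \<pi> p"

definition standard_P_morphism ::
    "'a list \<Rightarrow> ('a \<Rightarrow> 'a tail) \<Rightarrow> ('a \<Rightarrow> 'a list) \<Rightarrow> bool" where
  "standard_P_morphism p q \<phi> \<longleftrightarrow>
     palindrome p \<and> (\<forall>x. admissible_tail p (q x) \<and> sandwich p (q x) [] (\<phi> x))"

text \<open>The word \<open>p q\<^sub>x p\<close> is \<open>\<phi> x @ p\<close>. An occurrence of it in \<open>\<phi>(y\<^sub>1\<dots>y\<^sub>n) p\<close> is a factorization
  \<open>u (p q\<^sub>x p) v\<close>; the index \<open>m\<close> below counts from 0.\<close>

definition special_standard_P_morphism ::
    "'a list \<Rightarrow> ('a \<Rightarrow> 'a tail) \<Rightarrow> ('a \<Rightarrow> 'a list) \<Rightarrow> bool" where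
  "special_standard_P_morphism p q \<phi> \<longleftrightarrow>
     standard_P_morphism p q \<phi> \<and>
     (\<forall>x. \<phi> x \<noteq> []) \<and>
     (\<forall>x y. x \<noteq> y \<longrightarrow> last (\<phi> x) \<noteq> last (\<phi> y)) \<and>
     (\<forall>x ys u v. ext \<phi> ys @ p = u @ (\<phi> x @ p) @ v \<longrightarrow>
        (\<exists>m < length ys. u = ext \<phi> (take m ys) \<and> \<phi> x @ p = \<phi> (ys ! m) @ p))"

definition special_P_morphism :: "('a \<Rightarrow> 'a list) \<Rightarrow> bool" where
  "special_P_morphism \<psi> \<longleftrightarrow>
     (\<exists>p q \<phi> p' p''. special_standard_P_morphism p q \<phi> \<and> p = p' @ p'' \<and>
        (\<forall>x. sandwich p'' (q x) p' (\<psi> x)))"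

end

theory Submission
  imports Defs
begin

text \<open>Appending a letter creates at most one new palindromic factor, necessarily a suffix, so the
  defect stays constant exactly when the extended word has a palindromic suffix that did not occur
  before. An infinite word is thus almost rich iff almost every prefix ends with a new palindrome,
  and over a finite alphabet the lengths of these palindromes tend to infinity.

  Put \<open>\<Phi>(w) = \<phi>(w) p\<close>. This map commutes with reversal, and since \<open>\<psi>(x) = p'' q\<^sub>x p'\<close>
  with \<open>p = p' p''\<close> gives \<open>\<Phi>(w) = p' \<psi>(w) p''\<close>, the defects of \<open>\<psi>(w)\<close> and of \<open>\<Phi>(w)\<close> differ
  by at most \<open>|p|\<close>. If \<open>z v z\<close> is a new palindrome at the end of \<open>w z\<close> and \<open>v\<close> is nonempty, then
  synchronization makes the central factors of \<open>\<Phi>(z v z)\<close> that properly contain \<open>\<Phi>(v)\<close> new at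
  each letter between \<open>\<Phi>(w)\<close> and \<open>\<Phi>(w z)\<close>. Conversely, a new palindromic suffix of \<open>\<Phi>(w z)\<close> that
  is long enough to contain \<open>\<Phi>(z)\<close> begins, being a palindrome, with \<open>\<Phi>(z)\<close>, hence equals \<open>\<Phi>(v)\<close>
  for a new palindromic suffix \<open>v\<close> of \<open>w z\<close>.\<close>

section \<open>Palindromic suffixes and the defect\<close>

lemma palindrome_prefix_iff_suffix:
  assumes "palindrome u" "palindrome v"
  shows "prefix u v \<longleftrightarrow> suffix u v"
  using assms unfolding palindrome_def suffix_to_prefix by simp

lemma strict_prefix_snocE:
  assumes "strict_prefix u w"
  obtains y c where "w = u @ y @ [c]"
proof -
  obtain a as where w: "w = u @ a # as" using assms by (elim strict_prefixE')
  then obtain y c where "a # as = y @ [c]" by (metis list.distinct(1) rev_exhaust)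
  then show thesis using w that by metis
qed

lemma palindrome_Cons_snoc: "palindrome (a # v @ [b]) \<longleftrightarrow> a = b \<and> palindrome v"
  unfolding palindrome_def by auto

lemma long_palindromeE:
  assumes "palindrome w" "length w > 1"
  obtains a v where "w = a # v @ [a]"
proof -
  obtain a w' where "w = a # w'" "w' \<noteq> []" using assms(2) by (cases w) auto
  moreover from this obtain v b where "w' = v @ [b]" by (metis rev_exhaust)
  ultimately have "w = a # v @ [b]" by simp
  with assms(1) that show thesis by (metis palindrome_Cons_snoc)
qed

lemma finite_PAL: "finite (PAL w)"
proof (rule finite_subset)
  show "PAL w \<subseteq> set (sublists w)" by (auto simp: PAL_def)
qed simp

lemma PAL_mono: "sublist v w \<Longrightarrow> PAL v \<subseteq> PAL w"
  unfolding PAL_def by (auto intro: sublist_order.order_trans)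

lemma PAL_rev: "PAL (rev w) = PAL w"
  unfolding PAL_def palindrome_def by (metis sublist_rev_right)

lemma defect_rev: "defect (rev w) = defect w"
  by (simp add: defect_def PAL_rev)

definition new_palindromic_suffixes :: "'a list \<Rightarrow> 'a list \<Rightarrow> 'a list set" where
  "new_palindromic_suffixes u w = {v. palindrome v \<and> suffix v w \<and> \<not> sublist v u}"

lemma new_palindromic_suffixes_antimono:
  "sublist u u' \<Longrightarrow> new_palindromic_suffixes u' w \<subseteq> new_palindromic_suffixes u w"
  unfolding new_palindromic_suffixes_def using sublist_order.order_trans by blast

lemma PAL_snoc: "PAL (w @ [a]) = PAL w \<union> new_palindromic_suffixes w (w @ [a])"
  unfolding PAL_def new_palindromic_suffixes_def sublist_snoc by blast

lemma new_palindromic_suffix_snoc_unique: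
  assumes "u \<in> new_palindromic_suffixes w (w @ [a])" "v \<in> new_palindromic_suffixes w (w @ [a])"
  shows "u = v"
proof -
  have "\<not> strict_suffix u v"
    if u: "u \<in> new_palindromic_suffixes w (w @ [a])"
      and v: "v \<in> new_palindromic_suffixes w (w @ [a])" for u v
  proof
    assume "strict_suffix u v"
    then have "strict_prefix u v"
      using u v palindrome_prefix_iff_suffix[of u v]
      by (auto simp: new_palindromic_suffixes_def strict_prefix_def strict_suffix_def)
    then obtain y b where "v = u @ y @ [b]" by (rule strict_prefix_snocE)
    moreover obtain x where "w @ [a] = x @ v"
      using v by (auto simp: new_palindromic_suffixes_def suffix_def)
    ultimately have "w = x @ u @ y" by simp
    then show False using u by (simp add: new_palindromic_suffixes_def)
  qed
  moreover have "suffix u v \<or> suffix v u"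
    using assms suffix_same_cases[of u "w @ [a]" v] by (simp add: new_palindromic_suffixes_def)
  ultimately show ?thesis using assms by (auto simp: strict_suffix_def)
qed

lemma defect_snoc:
  "defect (w @ [a]) =
    (if new_palindromic_suffixes w (w @ [a]) = {} then defect w + 1 else defect w)"
proof (cases "new_palindromic_suffixes w (w @ [a]) = {}")
  case True
  then show ?thesis by (simp add: defect_def PAL_snoc)
next
  case False
  then obtain v where v: "v \<in> new_palindromic_suffixes w (w @ [a])" by blast
  then have "new_palindromic_suffixes w (w @ [a]) = {v}"
    using new_palindromic_suffix_snoc_unique[OF _ v] by blast
  then have "PAL (w @ [a]) = insert v (PAL w)" unfolding PAL_snoc by simp
  moreover have "v \<notin> PAL w" using v by (simp add: PAL_def new_palindromic_suffixes_def)
  ultimately show ?thesis using False by (simp add: defect_def finite_PAL)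
qed

lemma defect_append_right: "defect w \<le> defect (w @ v)"
proof (induction v rule: rev_induct)
  case (snoc a v)
  then show ?case using defect_snoc[of "w @ v" a] by (simp split: if_splits)
qed simp

lemma defect_append_left: "defect w \<le> defect (v @ w)"
  using defect_append_right[of "rev w" "rev v"] by (metis defect_rev rev_append)

lemma defect_mono: "sublist v w \<Longrightarrow> defect v \<le> defect w"
  unfolding sublist_def using defect_append_left defect_append_right by (metis order_trans)

lemma defect_append_eq_iff:
  "defect (u @ v) = defect u \<longleftrightarrow>
    (\<forall>y c. prefix (y @ [c]) v \<longrightarrow> new_palindromic_suffixes (u @ y) (u @ y @ [c]) \<noteq> {})"
proof (induction v rule: rev_induct)
  case (snoc a v)
  have "defect (u @ v @ [a]) = defect u \<longleftrightarrow>
      new_palindromic_suffixes (u @ v) (u @ v @ [a]) \<noteq> {} \<and> defect (u @ v) = defect u"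
    using defect_snoc[of "u @ v" a] defect_append_right[of u v] by auto
  then show ?case unfolding snoc.IH prefix_snoc by auto
qed simp

lemma ex_new_palindromic_suffix:
  assumes "strict_prefix u w" "defect w = defect u"
  shows "\<exists>v. v \<in> new_palindromic_suffixes u w"
proof -
  obtain y c where w: "w = u @ y @ [c]" using assms(1) by (rule strict_prefix_snocE)
  then have "new_palindromic_suffixes (u @ y) w \<noteq> {}"
    using assms(2) defect_append_eq_iff[of u "y @ [c]"] by simp
  then show ?thesis using new_palindromic_suffixes_antimono[of u "u @ y" w] by auto
qed

lemma defect_extension_le:
  "defect (u @ w @ v) \<le> defect w + int (length u + length v)"
proof -
  have "card (PAL w) \<le> card (PAL (u @ w @ v))"
    by (intro card_mono finite_PAL PAL_mono) simp
  then show ?thesis by (simp add: defect_def)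
qed

section \<open>Bounded defect\<close>

lemma bdd_above_defect_extension_iff:
  "bdd_above (range (\<lambda>i. defect (u @ W i @ v))) \<longleftrightarrow> bdd_above (range (\<lambda>i. defect (W i)))"
proof
  assume "bdd_above (range (\<lambda>i. defect (u @ W i @ v)))"
  then obtain B where bound: "\<And>i. defect (u @ W i @ v) \<le> B" by (auto simp: bdd_above_def)
  have "defect (W i) \<le> B" for i
    using defect_mono[OF sublist_appendI, of "W i" u v] bound[of i] by linarith
  then show "bdd_above (range (\<lambda>i. defect (W i)))" by (rule bdd_aboveI2)
next
  assume "bdd_above (range (\<lambda>i. defect (W i)))"
  then obtain B where bound: "\<And>i. defect (W i) \<le> B" by (auto simp: bdd_above_def)
  have "defect (u @ W i @ v) \<le> B + int (length u + length v)" for i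
    using defect_extension_le[of u "W i" v] bound[of i] by linarith
  then show "bdd_above (range (\<lambda>i. defect (u @ W i @ v)))" by (rule bdd_aboveI2)
qed

lemma bdd_above_range_iff_eventually_const:
  fixes f :: "nat \<Rightarrow> int"
  assumes "mono f"
  shows "bdd_above (range f) \<longleftrightarrow> (\<forall>\<^sub>F n in sequentially. f (Suc n) = f n)"
proof
  assume "bdd_above (range f)"
  then obtain B where "\<And>n. f n \<le> B" by (auto simp: bdd_above_def)
  then have "range f \<subseteq> {f 0..B}" using monoD[OF assms le0] by auto
  then have finite_range: "finite (range f)" by (rule finite_subset) simp
  then have "Max (range f) \<in> range f" by (intro Max_in) auto
  then obtain N where max: "f N = Max (range f)" by auto
  have const: "f n = f N" if "n \<ge> N" for n
  proof (rule antisym)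
    show "f n \<le> f N" unfolding max by (rule Max_ge[OF finite_range rangeI])
    show "f N \<le> f n" using assms that by (rule monoD)
  qed
  show "\<forall>\<^sub>F n in sequentially. f (Suc n) = f n"
  proof
    show "f (Suc n) = f n" if "n \<ge> N" for n using const[of n] const[of "Suc n"] that by simp
  qed
next
  assume "\<forall>\<^sub>F n in sequentially. f (Suc n) = f n"
  then obtain N where step: "\<And>n. n \<ge> N \<Longrightarrow> f (Suc n) = f n"
    by (auto simp: eventually_sequentially)
  have const: "f n = f N" if "n \<ge> N" for n
    using that by (induction rule: dec_induct) (simp_all add: step)
  have "f n \<le> f N" for n using const[of n] monoD[OF assms, of n N] by (cases "n \<le> N") simp_all
  then show "bdd_above (range f)" by (rule bdd_aboveI2)
qed

lemma bdd_above_defect_iff_eventually_const: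
  assumes "\<And>k. prefix (W k) (W (Suc k))"
  shows "bdd_above (range (\<lambda>k. defect (W k))) \<longleftrightarrow>
    (\<forall>\<^sub>F k in sequentially. defect (W (Suc k)) = defect (W k))"
  by (intro bdd_above_range_iff_eventually_const mono_iff_le_Suc[THEN iffD2] allI
    defect_mono prefix_imp_sublist assms)

lemma eventually_not_new_palindromic_suffix:
  assumes "\<And>k. prefix (W k) (W (Suc k))"
  shows "\<forall>\<^sub>F k in sequentially. v \<notin> new_palindromic_suffixes (W k) (W (Suc k))"
proof (cases "\<exists>j. sublist v (W j)")
  case True
  then obtain j where j: "sublist v (W j)" by blast
  have "sublist v (W k)" if "k \<ge> j" for k
    using prefix_order.lift_Suc_mono_le[of W, OF assms that] j
    by (meson prefix_imp_sublist sublist_order.order_trans)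
  then show ?thesis
    unfolding eventually_sequentially new_palindromic_suffixes_def by blast
next
  case False
  then have "\<not> suffix v (W (Suc k))" for k using suffix_imp_sublist by blast
  then show ?thesis by (simp add: new_palindromic_suffixes_def)
qed

lemma eventually_long_new_palindromic_suffix:
  fixes W :: "nat \<Rightarrow> 'a list"
  assumes "finite (UNIV :: 'a set)" and chain: "\<And>k. strict_prefix (W k) (W (Suc k))"
    and bdd: "bdd_above (range (\<lambda>k. defect (W k)))"
  shows "\<forall>\<^sub>F k in sequentially. \<exists>v \<in> new_palindromic_suffixes (W k) (W (Suc k)). length v > n"
proof -
  have prefix: "prefix (W k) (W (Suc k))" for k using chain by (simp add: strict_prefix_def)
  have "\<forall>\<^sub>F k in sequentially. defect (W (Suc k)) = defect (W k)"
    using bdd bdd_above_defect_iff_eventually_const[of W, OF prefix] by blast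
  moreover have "\<forall>\<^sub>F k in sequentially. \<forall>v \<in> {v. length v \<le> n}.
      v \<notin> new_palindromic_suffixes (W k) (W (Suc k))"
    using finite_lists_length_le[OF assms(1), of n]
    by (intro eventually_ball_finite ballI eventually_not_new_palindromic_suffix prefix) simp
  ultimately show ?thesis
  proof eventually_elim
    case (elim k)
    then show ?case
      using ex_new_palindromic_suffix[OF chain[of k]] by (metis mem_Collect_eq not_le)
  qed
qed

lemma bdd_above_defect_transfer:
  fixes V :: "nat \<Rightarrow> 'a list" and W :: "nat \<Rightarrow> 'b list"
  assumes "finite (UNIV :: 'a set)"
    and "\<And>k. strict_prefix (V k) (V (Suc k))" and "\<And>k. prefix (W k) (W (Suc k))"
    and "bdd_above (range (\<lambda>k. defect (V k)))"
    and transfer: "\<And>k v. \<lbrakk>v \<in> new_palindromic_suffixes (V k) (V (Suc k)); length v > n\<rbrakk>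
      \<Longrightarrow> defect (W (Suc k)) = defect (W k)"
  shows "bdd_above (range (\<lambda>k. defect (W k)))"
proof -
  have "\<forall>\<^sub>F k in sequentially. \<exists>v \<in> new_palindromic_suffixes (V k) (V (Suc k)). length v > n"
    using assms(1,2,4) by (rule eventually_long_new_palindromic_suffix)
  then have "\<forall>\<^sub>F k in sequentially. defect (W (Suc k)) = defect (W k)"
    by eventually_elim (auto intro: transfer)
  with assms(3) show ?thesis by (simp add: bdd_above_defect_iff_eventually_const)
qed

lemma almost_rich_iff_bdd_above_defect_stake:
  assumes n: "\<And>k. k \<le> n k"
  shows "almost_rich s \<longleftrightarrow> bdd_above (range (\<lambda>k. defect (stake (n k) s)))"
proof
  assume "almost_rich s"
  then obtain B where bound: "\<And>w. w \<in> factors s \<Longrightarrow> defect w \<le> B" by (auto simp: almost_rich_def)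
  have "stake (n k) s \<in> factors s" for k
    unfolding factors_def by (metis (mono_tags, lifting) mem_Collect_eq sdrop.simps(1))
  then show "bdd_above (range (\<lambda>k. defect (stake (n k) s)))"
    by (intro bdd_aboveI2[where M = B] bound)
next
  assume "bdd_above (range (\<lambda>k. defect (stake (n k) s)))"
  then obtain B where bound: "\<And>k. defect (stake (n k) s) \<le> B" by (auto simp: bdd_above_def)
  have "defect (stake j (sdrop i s)) \<le> B" for i j
  proof -
    have "stake (n (i + j)) s =
        stake i s @ stake j (sdrop i s) @ stake (n (i + j) - (i + j)) (sdrop (i + j) s)"
      using n[of "i + j"] by (simp add: stake_add flip: append_assoc)
    then have "defect (stake j (sdrop i s)) \<le> defect (stake (n (i + j)) s)"
      by (simp add: defect_mono)
    then show ?thesis using bound[of "i + j"] by linarith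
  qed
  then show "almost_rich s" by (auto simp: almost_rich_def factors_def)
qed

section \<open>Special standard P-morphisms\<close>

lemma ext_simps [simp]:
  "ext f [] = []" "ext f (x # xs) = f x @ ext f xs" "ext f (xs @ ys) = ext f xs @ ext f ys"
  by (simp_all add: ext_def)

lemma ext_eq_Nil_iff [simp]: "ext f w = [] \<longleftrightarrow> (\<forall>x \<in> set w. f x = [])"
  by (simp add: ext_def)

lemma rev_ext: "rev (ext f w) = ext (rev \<circ> f) (rev w)"
  by (simp add: ext_def rev_concat rev_map)

lemma ext_conjugate:
  assumes "\<And>x. r @ g x = f x @ r"
  shows "r @ ext g w = ext f w @ r"
proof (induction w)
  case (Cons x w)
  have "r @ ext g (x # w) = (f x @ r) @ ext g w" by (simp flip: assms)
  then show ?case by (simp add: Cons.IH)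
qed simp

locale standard_morphism =
  fixes p :: "'a list" and q :: "'a \<Rightarrow> 'a tail" and \<phi> :: "'a \<Rightarrow> 'a list"
  assumes standard: "standard_P_morphism p q \<phi>"
begin

definition completed_image :: "'a list \<Rightarrow> 'a list" (\<open>\<Phi>\<close>) where
  "\<Phi> w = ext \<phi> w @ p"

lemma rev_p: "rev p = p"
  using standard by (simp add: standard_P_morphism_def palindrome_def)

lemma admissible_tail_q: "admissible_tail p (q x)"
  using standard by (simp add: standard_P_morphism_def)

lemma sandwich_image: "sandwich p (q x) [] (\<phi> x)"
  using standard by (simp add: standard_P_morphism_def)

lemma p_append_rev_image: "p @ rev (\<phi> x) = \<phi> x @ p"
proof (cases "q x")
  case (Pos r)
  then have "rev r = r" "\<phi> x = p @ r"
    using admissible_tail_q[of x] sandwich_image[of x] by (auto simp: palindrome_def)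
  then show ?thesis by (simp add: rev_p)
next
  case (Neg \<pi>)
  then have "rev \<pi> = \<pi>" and p: "p = \<phi> x @ \<pi>"
    using admissible_tail_q[of x] sandwich_image[of x] by (auto simp: palindrome_def)
  then have "p = \<pi> @ rev (\<phi> x)" by (metis rev_p rev_append)
  with p show ?thesis by (metis append.assoc)
qed

lemma completed_image_eq_p_append: "\<Phi> w = p @ ext (rev \<circ> \<phi>) w"
  unfolding completed_image_def by (rule ext_conjugate[symmetric]) (simp add: p_append_rev_image)

lemma rev_completed_image: "rev (\<Phi> w) = \<Phi> (rev w)"
  unfolding completed_image_def[of w] by (simp add: rev_p rev_ext completed_image_eq_p_append)

lemma completed_image_append_left: "\<Phi> (v @ w) = ext \<phi> v @ \<Phi> w"
  by (simp add: completed_image_def)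

lemma completed_image_append_right: "\<Phi> (v @ w) = \<Phi> v @ ext (rev \<circ> \<phi>) w"
  by (simp add: completed_image_eq_p_append)

lemma completed_image_append_both:
  "\<Phi> (u @ w @ v) = ext \<phi> u @ \<Phi> w @ ext (rev \<circ> \<phi>) v"
  unfolding completed_image_append_left[of u] completed_image_append_right[of w] ..

lemma sublist_completed_image: "sublist v w \<Longrightarrow> sublist (\<Phi> v) (\<Phi> w)"
  unfolding sublist_def[of v w] by (auto simp only: completed_image_append_both sublist_appendI)

lemma conjugate_image:
  assumes p_eq: "p = p' @ p''" and sandwich: "sandwich p'' (q x) p' (\<psi> x)"
  shows "p' @ \<psi> x = \<phi> x @ p'"
proof (cases "q x")
  case (Pos r)
  then show ?thesis using sandwich sandwich_image[of x] p_eq by simp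
next
  case (Neg \<pi>)
  then obtain \<pi>1 \<pi>2 u v where split: "\<pi> = \<pi>1 @ \<pi>2" "p'' = u @ \<pi>2" "p' = \<pi>1 @ v" "\<psi> x = u @ v"
    using sandwich by auto
  have "p = \<phi> x @ \<pi>" using Neg sandwich_image[of x] by auto
  then have "(p' @ u) @ \<pi>2 = (\<phi> x @ \<pi>1) @ \<pi>2" using p_eq split(1,2) by simp
  then have "p' @ u = \<phi> x @ \<pi>1" by (simp only: append_same_eq)
  then have "(p' @ u) @ v = (\<phi> x @ \<pi>1) @ v" by (rule arg_cong)
  then show ?thesis using split(3,4) by simp
qed

lemma completed_image_eq_conjugate:
  assumes p_eq: "p = p' @ p''" and "\<And>x. sandwich p'' (q x) p' (\<psi> x)"
  shows "\<Phi> w = p' @ ext \<psi> w @ p''"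
proof -
  have "\<Phi> w = (ext \<phi> w @ p') @ p''" unfolding completed_image_def by (simp add: p_eq)
  also have "ext \<phi> w @ p' = p' @ ext \<psi> w"
    by (rule ext_conjugate[symmetric]) (rule conjugate_image[OF assms])
  finally show ?thesis by simp
qed

end

locale special_standard_morphism =
  fixes p :: "'a list" and q :: "'a \<Rightarrow> 'a tail" and \<phi> :: "'a \<Rightarrow> 'a list"
  assumes special: "special_standard_P_morphism p q \<phi>"
begin

sublocale standard_morphism p q \<phi>
  using special by unfold_locales (simp add: special_standard_P_morphism_def)

lemma image_nonempty [simp]: "\<phi> x \<noteq> []"
  using special by (simp add: special_standard_P_morphism_def)

lemma last_image_inject: "last (\<phi> x) = last (\<phi> y) \<longleftrightarrow> x = y"
  using special unfolding special_standard_P_morphism_def by blast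

lemma strict_prefix_completed_image_snoc: "strict_prefix (\<Phi> w) (\<Phi> (w @ [x]))"
  by (simp add: completed_image_append_right strict_prefix_def)

lemma ext_eq_append_suffix_imageE:
  assumes "ext \<phi> ys = u @ r" "suffix r (\<phi> x)" "r \<noteq> []"
  obtains ys' where "ys = ys' @ [x]"
proof -
  have "ys \<noteq> []" using assms(1,3) by auto
  then obtain ys' y where ys: "ys = ys' @ [y]" by (metis rev_exhaust)
  then have "last (\<phi> y) = last r"
    using assms(1,3) by (metis ext_simps append_Nil2 image_nonempty last_appendR)
  also have "\<dots> = last (\<phi> x)" using assms(2,3) by (auto simp: suffix_def)
  finally show thesis using that ys by (simp add: last_image_inject)
qed

lemma synchronized_letter:
  assumes "\<Phi> ys = u @ \<Phi> [x] @ v"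
  obtains ys1 ys2 where "ys = ys1 @ [x] @ ys2" "u = ext \<phi> ys1"
proof -
  have "ext \<phi> ys @ p = u @ (\<phi> x @ p) @ v" using assms by (simp add: completed_image_def)
  then obtain m where m: "m < length ys" "u = ext \<phi> (take m ys)" "\<phi> x @ p = \<phi> (ys ! m) @ p"
    using special unfolding special_standard_P_morphism_def by blast
  then have "ys ! m = x" by (metis append_same_eq last_image_inject)
  then have "ys = take m ys @ [x] @ drop (Suc m) ys" using id_take_nth_drop[OF m(1)] by simp
  with m(2) that show thesis by blast
qed

lemma synchronized_left:
  assumes "w \<noteq> []" "\<Phi> ys = u @ \<Phi> w @ v"
  shows "\<exists>ys1 ys2. ys = ys1 @ w @ ys2 \<and> u = ext \<phi> ys1"
  using assms
proof (induction w arbitrary: u rule: list_nonempty_induct)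
  case (single x)
  then show ?case by (elim synchronized_letter) blast
next
  case (cons x w)
  have "\<Phi> ys = (u @ \<phi> x) @ \<Phi> w @ v" using cons.prems by (simp add: completed_image_def)
  from cons.IH[OF this] obtain ys1 ys2 where ys: "ys = ys1 @ w @ ys2" "ext \<phi> ys1 = u @ \<phi> x"
    by metis
  then obtain ys1' where "ys1 = ys1' @ [x]"
    using ext_eq_append_suffix_imageE[of ys1 u "\<phi> x" x] by auto
  with ys have "ys = ys1' @ (x # w) @ ys2" "u = ext \<phi> ys1'" by simp_all
  then show ?case by blast
qed

lemma synchronized:
  assumes "\<Phi> ys = u @ \<Phi> w @ v" "w \<noteq> []"
  obtains ys1 ys2 where "ys = ys1 @ w @ ys2" "u = ext \<phi> ys1" "v = ext (rev \<circ> \<phi>) ys2"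
proof -
  obtain ys1 ys2 where ys: "ys = ys1 @ w @ ys2" "u = ext \<phi> ys1"
    using synchronized_left[OF assms(2,1)] by blast
  moreover have "v = ext (rev \<circ> \<phi>) ys2"
    using assms(1) unfolding ys completed_image_append_both by simp
  ultimately show thesis by (rule that)
qed

lemma completed_image_inject: "\<Phi> v = \<Phi> w \<longleftrightarrow> v = w"
proof
  assume eq: "\<Phi> v = \<Phi> w"
  show "v = w"
  proof (cases "v = []")
    case True
    then show ?thesis using eq by (simp add: completed_image_def)
  next
    case False
    have "\<Phi> w = [] @ \<Phi> v @ []" using eq by simp
    then obtain ys1 ys2 where w: "w = ys1 @ v @ ys2"
      and "ext \<phi> ys1 = []" "ext (rev \<circ> \<phi>) ys2 = []"
      using False by (metis synchronized)
    then have "ys1 = []" "ys2 = []" by simp_all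
    with w show ?thesis by simp
  qed
qed simp

lemma palindrome_completed_image: "palindrome (\<Phi> w) \<longleftrightarrow> palindrome w"
  by (simp add: palindrome_def rev_completed_image completed_image_inject)

lemma synchronized_enclosed:
  assumes "\<Phi> ys = u @ (rev r @ \<Phi> w @ r) @ v" "prefix r (rev (\<phi> z))" "r \<noteq> []" "w \<noteq> []"
  obtains ys1 ys2 where "ys = ys1 @ (z # w @ [z]) @ ys2" "r @ v = rev (\<phi> z) @ ext (rev \<circ> \<phi>) ys2"
proof -
  have suffix: "suffix (rev r) (\<phi> z)" using assms(2) by (simp add: suffix_to_prefix)
  have "\<Phi> ys = (u @ rev r) @ \<Phi> w @ (r @ v)" using assms(1) by simp
  then obtain a b where ys: "ys = a @ w @ b"
    and left: "u @ rev r = ext \<phi> a" and right: "r @ v = ext (rev \<circ> \<phi>) b"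
    using assms(4) by (rule synchronized)
  obtain a' where a': "a = a' @ [z]"
    using ext_eq_append_suffix_imageE[OF left[symmetric] suffix] assms(3) by auto
  have "ext \<phi> (rev b) = rev (ext (rev \<circ> \<phi>) b)" by (simp add: rev_ext comp_def)
  then have "ext \<phi> (rev b) = rev v @ rev r" by (simp flip: right)
  then obtain b' where "rev b = b' @ [z]"
    using ext_eq_append_suffix_imageE[OF _ suffix] assms(3) by auto
  then have b': "b = z # rev b'" by (simp add: rev_swap)
  show thesis
  proof
    show "ys = a' @ (z # w @ [z]) @ rev b'" by (simp add: ys a' b')
    show "r @ v = rev (\<phi> z) @ ext (rev \<circ> \<phi>) (rev b')" by (simp add: right b')
  qed
qed

lemma not_sublist_enclosed_completed_image:
  assumes fresh: "\<not> sublist (z # v @ [z]) w" and "v \<noteq> []" and "prefix (r @ [c]) (rev (\<phi> z))"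
  shows "\<not> sublist (rev (r @ [c]) @ \<Phi> v @ r @ [c]) (\<Phi> w @ r)" (is "\<not> sublist ?P _")
proof
  assume "sublist ?P (\<Phi> w @ r)"
  then obtain x y where occurrence: "\<Phi> w @ r = x @ ?P @ y" by (auto simp: sublist_def)
  obtain r' where r': "rev (\<phi> z) = (r @ [c]) @ r'" using assms(3) by (auto simp: prefix_def)
  then have "\<Phi> (w @ [z]) = (\<Phi> w @ r) @ c # r'" by (simp add: completed_image_append_right)
  also have "\<dots> = x @ ?P @ (y @ c # r')" unfolding occurrence by simp
  finally obtain ys1 ys2 where ys: "w @ [z] = ys1 @ (z # v @ [z]) @ ys2"
    and rest: "(r @ [c]) @ y @ c # r' = rev (\<phi> z) @ ext (rev \<circ> \<phi>) ys2"
    using assms(2,3) by (elim synchronized_enclosed) auto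
  \<comment> \<open>The left-hand side is longer than \<open>\<phi> z\<close>, so this occurrence of \<open>z v z\<close> is not the final one.\<close>
  have "ys2 \<noteq> []" using arg_cong[OF rest, of length] by (auto simp: r')
  then obtain ys2' where "w = ys1 @ (z # v @ [z]) @ ys2'"
    using ys by (cases ys2 rule: rev_cases) auto
  then show False using fresh by (auto simp: sublist_def)
qed

lemma new_palindromic_suffix_completed_image:
  assumes new: "z # v @ [z] \<in> new_palindromic_suffixes w (w @ [z])" and "v \<noteq> []"
    and prefix: "prefix (r @ [c]) (rev (\<phi> z))"
  shows "rev (r @ [c]) @ \<Phi> v @ r @ [c] \<in> new_palindromic_suffixes (\<Phi> w @ r) (\<Phi> w @ r @ [c])"
    (is "?P \<in> _")
proof -
  have "palindrome v"
    using new by (simp add: new_palindromic_suffixes_def palindrome_Cons_snoc)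
  then have "rev (\<Phi> v) = \<Phi> v" by (simp add: rev_completed_image palindrome_def)
  then have "palindrome ?P" by (simp add: palindrome_def)
  moreover have "suffix ?P (\<Phi> w @ r @ [c])"
  proof -
    obtain w' where "w = w' @ [z] @ v"
      using new by (auto simp: new_palindromic_suffixes_def suffix_def)
    moreover obtain r' where "\<phi> z = r' @ rev (r @ [c])"
      using prefix by (metis rev_rev_ident suffix_def suffix_to_prefix)
    ultimately have "\<Phi> w @ r @ [c] = (ext \<phi> w' @ r') @ ?P"
      by (simp add: completed_image_def)
    then show ?thesis by (rule suffixI)
  qed
  moreover have "\<not> sublist ?P (\<Phi> w @ r)"
    using new assms(2) prefix
    by (intro not_sublist_enclosed_completed_image) (simp_all add: new_palindromic_suffixes_def)
  ultimately show ?thesis by (simp add: new_palindromic_suffixes_def)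
qed

lemma defect_completed_image_snoc_eq:
  assumes "v \<in> new_palindromic_suffixes w (w @ [z])" "length v > 2"
  shows "defect (\<Phi> (w @ [z])) = defect (\<Phi> w)"
proof -
  have "palindrome v" "suffix v (w @ [z])"
    using assms(1) unfolding new_palindromic_suffixes_def by blast+
  moreover obtain a v' where "v = a # v' @ [a]"
    using \<open>palindrome v\<close> by (rule long_palindromeE) (use assms(2) in simp)
  ultimately have v: "v = z # v' @ [z]" by (metis append_Cons snoc_suffix_snoc)
  then have "v' \<noteq> []" using assms(2) by auto
  then have "new_palindromic_suffixes (\<Phi> w @ r) (\<Phi> w @ r @ [c]) \<noteq> {}"
    if "prefix (r @ [c]) (rev (\<phi> z))" for r c
    using new_palindromic_suffix_completed_image[of z v' w r c] assms(1) v that by auto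
  then show ?thesis
    by (simp add: completed_image_append_right defect_append_eq_iff)
qed

lemma defect_snoc_eq_if_completed_image:
  assumes new: "P \<in> new_palindromic_suffixes (\<Phi> w) (\<Phi> (w @ [x]))"
    and "length P \<ge> length (\<Phi> [x])"
  shows "defect (w @ [x]) = defect w"
proof -
  have "suffix (\<Phi> [x]) (\<Phi> (w @ [x]))" by (simp add: completed_image_append_left suffix_def)
  then have "suffix (\<Phi> [x]) P"
    using new assms(2) suffix_length_suffix by (auto simp: new_palindromic_suffixes_def)
  moreover have "palindrome P" using new by (simp add: new_palindromic_suffixes_def)
  moreover have "palindrome (\<Phi> [x])"
    unfolding palindrome_completed_image by (simp add: palindrome_def)
  ultimately have "prefix (\<Phi> [x]) P" by (simp add: palindrome_prefix_iff_suffix)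
  then obtain r where P_eq: "P = \<Phi> [x] @ r" by (auto simp: prefix_def)
  obtain u where "\<Phi> (w @ [x]) = u @ P"
    using new by (auto simp: new_palindromic_suffixes_def suffix_def)
  then obtain ys1 ys2 where ys: "w @ [x] = ys1 @ [x] @ ys2" "r = ext (rev \<circ> \<phi>) ys2"
    unfolding P_eq by (elim synchronized) auto
  define v where "v = [x] @ ys2"
  have "P = \<Phi> v" unfolding v_def completed_image_append_right P_eq ys(2) ..
  then have "palindrome v" "\<not> sublist v w"
    using new sublist_completed_image[of v w]
    by (auto simp: new_palindromic_suffixes_def palindrome_completed_image)
  moreover have "suffix v (w @ [x])" unfolding v_def ys(1) by (simp add: suffix_def)
  ultimately have "v \<in> new_palindromic_suffixes w (w @ [x])"
    unfolding new_palindromic_suffixes_def by blast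
  then show ?thesis by (auto simp: defect_snoc)
qed

lemma bdd_above_defect_completed_image_iff:
  assumes finite_alphabet: "finite (UNIV :: 'a set)"
  shows "bdd_above (range (\<lambda>k. defect (\<Phi> (stake k t)))) \<longleftrightarrow> almost_rich t"
proof -
  define T where "T k = stake k t" for k
  have T_Suc: "T (Suc k) = T k @ [t !! k]" for k unfolding T_def by (rule stake_Suc)
  have T_chain: "strict_prefix (T k) (T (Suc k))" for k by (simp add: T_Suc strict_prefix_def)
  have \<Phi>T_chain: "strict_prefix (\<Phi> (T k)) (\<Phi> (T (Suc k)))" for k
    unfolding T_Suc by (rule strict_prefix_completed_image_snoc)
  have "bdd_above (range (\<lambda>k. defect (\<Phi> (T k)))) \<longleftrightarrow> bdd_above (range (\<lambda>k. defect (T k)))"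
  proof
    assume "bdd_above (range (\<lambda>k. defect (T k)))"
    with finite_alphabet T_chain prefix_order.less_imp_le[OF \<Phi>T_chain]
    show "bdd_above (range (\<lambda>k. defect (\<Phi> (T k))))"
      by (rule bdd_above_defect_transfer) (unfold T_Suc, rule defect_completed_image_snoc_eq)
  next
    obtain L where length_le: "\<And>x. length (\<Phi> [x]) \<le> L"
      using finite_imageI[OF finite_alphabet, of "\<lambda>x. length (\<Phi> [x])"]
      by (auto simp: finite_nat_set_iff_bounded_le)
    assume "bdd_above (range (\<lambda>k. defect (\<Phi> (T k))))"
    with finite_alphabet \<Phi>T_chain prefix_order.less_imp_le[OF T_chain]
    show "bdd_above (range (\<lambda>k. defect (T k)))"
    proof (rule bdd_above_defect_transfer)
      fix k P
      assume "P \<in> new_palindromic_suffixes (\<Phi> (T k)) (\<Phi> (T (Suc k)))" "length P > L"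
      then show "defect (T (Suc k)) = defect (T k)"
        using length_le[of "t !! k"] unfolding T_Suc
        by (intro defect_snoc_eq_if_completed_image) auto
    qed
  qed
  also have "\<dots> \<longleftrightarrow> almost_rich t"
    unfolding T_def by (rule almost_rich_iff_bdd_above_defect_stake[symmetric]) simp
  finally show ?thesis unfolding T_def .
qed

end

section \<open>Images of infinite words\<close>

lemma ext_inf_unfold:
  assumes "\<And>x. f x \<noteq> []"
  shows "ext_inf f t = ext f (stake k t) @- ext_inf f (sdrop k t)"
proof (induction k arbitrary: t)
  case (Suc k)
  have "ext_inf f t = f (shd t) @- ext_inf f (stl t)"
    unfolding ext_inf_def by (metis assms flat_unfold stream.map_sel)
  then show ?case using Suc[of "stl t"] by simp
qed simp

lemma length_ext_ge:
  assumes "\<And>x. f x \<noteq> []"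
  shows "length w \<le> length (ext f w)"
proof (induction w)
  case (Cons x w)
  then show ?case using assms[of x] by (cases "f x") auto
qed simp

lemma almost_rich_ext_inf_iff:
  assumes "\<And>x. f x \<noteq> []"
  shows "almost_rich (ext_inf f t) \<longleftrightarrow> bdd_above (range (\<lambda>k. defect (ext f (stake k t))))"
proof -
  have "stake (length (ext f (stake k t))) (ext_inf f t) = ext f (stake k t)" for k
    by (subst ext_inf_unfold[OF assms, where k = k]) (simp add: stake_shift)
  moreover have "k \<le> length (ext f (stake k t))" for k
    using length_ext_ge[of f "stake k t"] assms by simp
  ultimately show ?thesis
    using almost_rich_iff_bdd_above_defect_stake[of "\<lambda>k. length (ext f (stake k t))" "ext_inf f t"]
    by simp
qed

theorem theorem6p24:
  fixes \<sigma> :: "'a::finite \<Rightarrow> 'a list" and s t :: "'a stream"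
  assumes "special_P_morphism \<sigma>"
    and "s = ext_inf \<sigma> t"
  shows "almost_rich s \<longleftrightarrow> almost_rich t"
proof -
  obtain p q \<phi> p' p'' where special: "special_standard_P_morphism p q \<phi>"
    and p_eq: "p = p' @ p''" and sandwich: "\<And>x. sandwich p'' (q x) p' (\<sigma> x)"
    using assms(1) unfolding special_P_morphism_def by blast
  interpret special_standard_morphism p q \<phi> by standard (rule special)
  have "\<sigma> x \<noteq> []" for x
    using conjugate_image[of p' p'' x \<sigma>, OF p_eq sandwich] image_nonempty[of x]
    by (metis append_Nil2 append_self_conv2)
  then have "almost_rich s \<longleftrightarrow> bdd_above (range (\<lambda>k. defect (ext \<sigma> (stake k t))))"
    unfolding assms(2) by (rule almost_rich_ext_inf_iff)
  also have "\<dots> \<longleftrightarrow> bdd_above (range (\<lambda>k. defect (completed_image (stake k t))))"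
    unfolding completed_image_eq_conjugate[OF p_eq sandwich]
    by (rule bdd_above_defect_extension_iff[symmetric])
  also have "\<dots> \<longleftrightarrow> almost_rich t"
    by (rule bdd_above_defect_completed_image_iff) simp
  finally show ?thesis .
qed

end
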